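(* Let $(G,p)$ be a countable bar-joint framework in a finite dimensional real normed linear space $(X,\|\cdot\|)$. Then the following statements are equivalent. (i) $(G,p)$ is infinitesimally rigid. (ii) $(G,p)$ contains a vertex-complete tower which has the flex cancellation property. (iii) $(G,p)$ contains a vertex-complete tower which is relatively infinitesimally rigid.
   Context: "Countable" means countably infinite. A bar-joint framework $(G,p)$ in a normed space $X$ consists of a simple graph $G=(V(G),E(G))$ and a map (placement) $p:V(G)\to X$, $v\mapsto p_v$, with $p_v\neq p_w$ whenever $vw\in E(G)$; it is countable if $G$ is. If $H$ is a subgraph of $G$, then $(H,p)$ ($p$ restricted to $V(H)$) is a subframework of $(G,p)$. An infinitesimal flex of $(G,p)$ is a map $u:V(G)\to X$ with $\|(p_v+tu_v)-(p_w+tu_w)\|-\|p_v-p_w\|=o(t)$ as $t\to0$ for each edge $vw$. The vector space of infinitesimal flexes is $\mathcal F(G,p)$. A continuous rigid motion of $X$ is a map $\Gamma:X\times[-1,1]\to X$ which is isometric in $x$ and continuous in $t$, with $\Gamma(x,0)=x$. An infinitesimal rigid motion is a map $\gamma:X\to X$ derived from a continuous rigid motion by $\gamma(x)=\frac{d}{dt}\Gamma(x,t)|_{t=0}$; these form a vector space $\mathcal T(X)$. An infinitesimal flex $u$ is trivial if there is $\gamma\in\mathcal T(X)$ with $u_v=\gamma(p_v)$ for all $v\in V(G)$. $(G,p)$ is infinitesimally rigid if every infinitesimal flex is trivial. A subframework $(H,p)$ is relatively infinitesimally rigid in $(G,p)$ if no non-trivial infinitesimal flex of $(H,p)$ extends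 to an infinitesimal flex of $(G,p)$. A tower is a sequence $\{(G_k,p_k):k\in\mathbb N\}$ of finite bar-joint frameworks such that $(G_k,p_k)$ is a subframework of $(G_{k+1},p_{k+1})$ for each $k$. $(G,p)$ contains the tower if each $(G_k,p_k)$ is a subframework of $(G,p)$; the tower is vertex-complete in $(G,p)$ if $V(G)=\bigcup_k V(G_k)$. The tower has the flex cancellation property if for each $k$ and each non-trivial infinitesimal flex $u_k$ of $(G_k,p_k)$ there is $m>k$ such that $u_k$ does not extend to an infinitesimal flex of $(G_m,p_m)$. The tower is relatively infinitesimally rigid if $(G_k,p_k)$ is relatively infinitesimally rigid in $(G_{k+1},p_{k+1})$ for each $k$. *)

theory Defs
  imports "HOL-Analysis.Analysis" "HOL-Library.Landau_Symbols"
begin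

record 'v graph =
  verts :: "'v set"
  edges :: "'v set set"

definition simple_graph :: "'v graph \<Rightarrow> bool" where
  "simple_graph G \<longleftrightarrow> (\<forall>e\<in>edges G. e \<subseteq> verts G \<and> card e = 2)"

definition subgraph :: "'v graph \<Rightarrow> 'v graph \<Rightarrow> bool" where
  "subgraph H G \<longleftrightarrow>
     simple_graph H \<and> simple_graph G \<and> verts H \<subseteq> verts G \<and> edges H \<subseteq> edges G"

text \<open>Placements and flexes are total functions on the vertex type, but only their values on
  the vertex set of the graph matter: every definition below is insensitive to the others.\<close>

definition framework :: "'v graph \<Rightarrow> ('v \<Rightarrow> 'a::real_normed_vector) \<Rightarrow> bool" where
  "framework G p \<longleftrightarrow> simple_graph G \<and> (\<forall>v w. {v, w} \<in> edges G \<longrightarrow> p v \<noteq> p w)"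

definition finite_framework :: "'v graph \<Rightarrow> ('v \<Rightarrow> 'a::real_normed_vector) \<Rightarrow> bool" where
  "finite_framework G p \<longleftrightarrow> framework G p \<and> finite (verts G)"

text \<open>Countable means countably infinite.\<close>

definition countable_framework :: "'v graph \<Rightarrow> ('v \<Rightarrow> 'a::real_normed_vector) \<Rightarrow> bool" where
  "countable_framework G p \<longleftrightarrow> framework G p \<and> countable (verts G) \<and> infinite (verts G)"

definition subframework ::
  "'v graph \<Rightarrow> ('v \<Rightarrow> 'a::real_normed_vector) \<Rightarrow> 'v graph \<Rightarrow> ('v \<Rightarrow> 'a) \<Rightarrow> bool" where
  "subframework H q G p \<longleftrightarrow>
     framework H q \<and> framework G p \<and> subgraph H G \<and> (\<forall>v\<in>verts H. q v = p v)"

definition infinitesimal_flex ::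
  "'v graph \<Rightarrow> ('v \<Rightarrow> 'a::real_normed_vector) \<Rightarrow> ('v \<Rightarrow> 'a) \<Rightarrow> bool" where
  "infinitesimal_flex G p u \<longleftrightarrow>
     (\<forall>v w. {v, w} \<in> edges G \<longrightarrow>
        (\<lambda>t::real. norm ((p v + t *\<^sub>R u v) - (p w + t *\<^sub>R u w)) - norm (p v - p w))
          \<in> o[at 0](\<lambda>t. t))"

text \<open>Only the values of \<open>\<Gamma> x t\<close> for \<open>t\<close> in \<open>[-1, 1]\<close> matter. Continuity in \<open>t\<close> is pointwise
  in \<open>x\<close>.\<close>

definition continuous_rigid_motion :: "('a::real_normed_vector \<Rightarrow> real \<Rightarrow> 'a) \<Rightarrow> bool" where
  "continuous_rigid_motion \<Gamma> \<longleftrightarrow>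
     (\<forall>t\<in>{-1..1}. \<forall>x y. dist (\<Gamma> x t) (\<Gamma> y t) = dist x y) \<and>
     (\<forall>x. continuous_on {-1..1} (\<Gamma> x)) \<and>
     (\<forall>x. \<Gamma> x 0 = x)"

definition infinitesimal_rigid_motion :: "('a::real_normed_vector \<Rightarrow> 'a) \<Rightarrow> bool" where
  "infinitesimal_rigid_motion \<gamma> \<longleftrightarrow>
     (\<exists>\<Gamma>. continuous_rigid_motion \<Gamma> \<and>
        (\<forall>x. (\<Gamma> x has_vector_derivative \<gamma> x) (at 0 within {-1..1})))"

definition trivial_flex ::
  "'v graph \<Rightarrow> ('v \<Rightarrow> 'a::real_normed_vector) \<Rightarrow> ('v \<Rightarrow> 'a) \<Rightarrow> bool" where
  "trivial_flex G p u \<longleftrightarrow>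
     infinitesimal_flex G p u \<and>
     (\<exists>\<gamma>. infinitesimal_rigid_motion \<gamma> \<and> (\<forall>v\<in>verts G. u v = \<gamma> (p v)))"

definition nontrivial_flex ::
  "'v graph \<Rightarrow> ('v \<Rightarrow> 'a::real_normed_vector) \<Rightarrow> ('v \<Rightarrow> 'a) \<Rightarrow> bool" where
  "nontrivial_flex G p u \<longleftrightarrow> infinitesimal_flex G p u \<and> \<not> trivial_flex G p u"

definition infinitesimally_rigid :: "'v graph \<Rightarrow> ('v \<Rightarrow> 'a::real_normed_vector) \<Rightarrow> bool" where
  "infinitesimally_rigid G p \<longleftrightarrow> (\<forall>u. infinitesimal_flex G p u \<longrightarrow> trivial_flex G p u)"

definition extends_to_flex ::
  "'v graph \<Rightarrow> ('v \<Rightarrow> 'a::real_normed_vector) \<Rightarrow> 'v graph \<Rightarrow> ('v \<Rightarrow> 'a) \<Rightarrow> bool" where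
  "extends_to_flex H u G p \<longleftrightarrow>
     (\<exists>u'. infinitesimal_flex G p u' \<and> (\<forall>v\<in>verts H. u' v = u v))"

definition relatively_infinitesimally_rigid ::
  "'v graph \<Rightarrow> ('v \<Rightarrow> 'a::real_normed_vector) \<Rightarrow> 'v graph \<Rightarrow> ('v \<Rightarrow> 'a) \<Rightarrow> bool" where
  "relatively_infinitesimally_rigid H q G p \<longleftrightarrow>
     subframework H q G p \<and> (\<forall>u. nontrivial_flex H q u \<longrightarrow> \<not> extends_to_flex H u G p)"

definition tower ::
  "(nat \<Rightarrow> 'v graph) \<Rightarrow> (nat \<Rightarrow> 'v \<Rightarrow> 'a::real_normed_vector) \<Rightarrow> bool" where
  "tower Gs ps \<longleftrightarrow>
     (\<forall>k. finite_framework (Gs k) (ps k)) \<and>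
     (\<forall>k. subframework (Gs k) (ps k) (Gs (Suc k)) (ps (Suc k)))"

definition contains_tower ::
  "'v graph \<Rightarrow> ('v \<Rightarrow> 'a::real_normed_vector) \<Rightarrow>
     (nat \<Rightarrow> 'v graph) \<Rightarrow> (nat \<Rightarrow> 'v \<Rightarrow> 'a) \<Rightarrow> bool" where
  "contains_tower G p Gs ps \<longleftrightarrow>
     tower Gs ps \<and> (\<forall>k. subframework (Gs k) (ps k) G p)"

definition vertex_complete :: "'v graph \<Rightarrow> (nat \<Rightarrow> 'v graph) \<Rightarrow> bool" where
  "vertex_complete G Gs \<longleftrightarrow> verts G = (\<Union>k. verts (Gs k))"

definition flex_cancellation ::
  "(nat \<Rightarrow> 'v graph) \<Rightarrow> (nat \<Rightarrow> 'v \<Rightarrow> 'a::real_normed_vector) \<Rightarrow> bool" where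
  "flex_cancellation Gs ps \<longleftrightarrow>
     (\<forall>k u. nontrivial_flex (Gs k) (ps k) u \<longrightarrow>
        (\<exists>m>k. \<not> extends_to_flex (Gs k) u (Gs m) (ps m)))"

definition relatively_rigid_tower ::
  "(nat \<Rightarrow> 'v graph) \<Rightarrow> (nat \<Rightarrow> 'v \<Rightarrow> 'a::real_normed_vector) \<Rightarrow> bool" where
  "relatively_rigid_tower Gs ps \<longleftrightarrow>
     (\<forall>k. relatively_infinitesimally_rigid (Gs k) (ps k) (Gs (Suc k)) (ps (Suc k)))"

end

theory Submission
  imports Defs
begin

text \<open>
  The implication from flex cancellation to rigidity glues the rigid motions that a flex induces on
  the finite stages of a tower. It rests on the fact that infinitesimal rigid motions of a
  finite-dimensional normed space are affine maps (\<open>infinitesimal_rigid_motion_affine\<close>), which comes from the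
  Mazur--Ulam theorem and the surjectivity of isometries in finite dimension. A chain of affine spans
  in finite dimension becomes constant, so the motion found on one sufficiently large stage serves for all
  vertices (\<open>flex_cancellation_imp_rigid\<close>).

  The converse, from rigidity to a relatively rigid tower, is an inverse limit argument. Flexes form a
  vector space even when the norm is not smooth, because the norm is convex
  (\<open>norm_stationary_add\<close>). On a finite vertex set, therefore, the flexes that extend to later and later
  stages of an exhaustion form a chain of finite-dimensional spaces, which becomes constant
  (\<open>linear_family_chain_stabilizes\<close>). A flex that extends far enough thus extends to every stage, and then
  coherently to the whole framework (\<open>finite_stage_extension_imp_extension\<close>), where rigidity makes it trivial.
  Passing to a subsequence of the exhaustion makes the next stage far enough.

  In a relatively rigid tower a nontrivial flex already fails to extend to the next stage, so such a
  tower has flex cancellation, which closes the cycle of implications.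
\<close>

section \<open>Isometries of finite-dimensional normed spaces\<close>

text \<open>Coordinates with respect to a basis \<open>A\<close> identify the space with a finite power of the reals. The
  norm is continuous and, by independence, nonzero on the compact boundary of the coordinate cube,
  hence bounded below there by some \<open>e > 0\<close>. So vectors in a ball have bounded coordinates, and the
  ball is a closed subset of a compact image of the cube.\<close>

lemma compact_cball_finite_span:
  fixes B :: "'a::real_normed_vector set"
  assumes "finite B" and span: "span B = UNIV"
  shows "compact (cball (0::'a) r)"
proof -
  obtain A where "A \<subseteq> B" and ind: "independent A" and BA: "B \<subseteq> span A"
    using maximal_independent_subset[of B] by metis
  have fin: "finite A" using \<open>A \<subseteq> B\<close> \<open>finite B\<close> finite_subset by blast
  have spanA: "span A = UNIV"
    using span_mono[OF BA] span by (simp add: span_span top.extremum_unique)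
  define T where "T c = (\<Sum>b\<in>A. c b *\<^sub>R b)" for c :: "'a \<Rightarrow> real"
  have T_scale: "T (\<lambda>b. k * c b) = k *\<^sub>R T c" for k c
    by (simp add: T_def scaleR_sum_right)
  \<comment> \<open>Coordinates off the basis are pinned to 0, which makes the cube compact by Tychonoff.\<close>
  define C where "C = PiE UNIV (\<lambda>b. if b \<in> A then {-1..1::real} else {0})"
  define S where "S = C \<inter> (\<Union>b\<in>A. {c. \<bar>c b\<bar> = 1})"
  have "compactin (product_topology (\<lambda>i. euclidean) UNIV) C"
    unfolding C_def compactin_PiE by auto
  then have compC: "compact C"
    by (simp add: euclidean_product_topology)
  have "closed {c::'a \<Rightarrow> real. \<bar>c b\<bar> = 1}" for b
    by (intro closed_Collect_eq continuous_intros continuous_on_product_coordinates)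
  then have compS: "compact S"
    unfolding S_def using compC fin by (intro compact_Int_closed closed_UN) auto
  have contT: "continuous_on X T" for X
    unfolding T_def
    by (intro continuous_intros continuous_on_subset[OF continuous_on_product_coordinates]) auto
  have nz: "T c \<noteq> 0" if "c \<in> S" for c
  proof
    assume "T c = 0"
    then have "\<forall>b\<in>A. c b = 0"
      using ind fin unfolding dependent_finite[OF fin] T_def by blast
    then show False using that by (auto simp: S_def)
  qed
  obtain e where e: "e > 0" "\<And>c. c \<in> S \<Longrightarrow> e \<le> norm (T c)"
  proof (cases "S = {}")
    case True
    then show ?thesis using that[of 1] by auto
  next
    case False
    have "continuous_on S (\<lambda>c. norm (T c))" by (intro continuous_intros contT)
    then obtain c0 where "c0 \<in> S" "\<forall>c\<in>S. norm (T c0) \<le> norm (T c)"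
      using continuous_attains_inf[OF compS False] by blast
    then show ?thesis using that[of "norm (T c0)"] nz by auto
  qed
  define R where "R = \<bar>r\<bar> / e + 1"
  have "R > 0" using \<open>e > 0\<close> by (simp add: R_def add_nonneg_pos)
  have "cball 0 r \<subseteq> (\<lambda>c. R *\<^sub>R T c) ` C"
  proof
    fix x :: 'a assume "x \<in> cball 0 r"
    then have x: "norm x \<le> r" by simp
    have "x \<in> span A" using spanA by simp
    then obtain c' where c': "x = T c'"
      unfolding span_finite[OF fin] T_def by auto
    define c where "c b = (if b \<in> A then c' b else 0)" for b
    have c: "x = T c" unfolding c' T_def c_def by (intro sum.cong) auto
    have bound: "\<bar>c b\<bar> \<le> R" for b
    proof (cases "A = {} \<or> (\<forall>b\<in>A. c b = 0)")
      case True
      then show ?thesis using \<open>R > 0\<close> by (auto simp: c_def)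
    next
      case False
      define M where "M = Max ((\<lambda>b. \<bar>c b\<bar>) ` A)"
      have le: "\<bar>c b\<bar> \<le> M" if "b \<in> A" for b
        unfolding M_def using fin that by simp
      have "M \<in> (\<lambda>b. \<bar>c b\<bar>) ` A" unfolding M_def using fin False by (intro Max_in) auto
      then obtain b0 where b0: "b0 \<in> A" "\<bar>c b0\<bar> = M" by auto
      have "M > 0" using False le by (metis abs_ge_zero abs_le_zero_iff le_less order_trans)
      have "(\<lambda>b. inverse M * c b) \<in> S"
        unfolding S_def C_def
      proof (intro IntI UN_I[of b0] CollectI PiE_I)
        fix b
        show "inverse M * c b \<in> (if b \<in> A then {-1..1} else {0})"
          using le[of b] \<open>M > 0\<close> by (auto simp: c_def field_simps abs_le_iff)
        show "\<bar>inverse M * c b0\<bar> = 1"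
          using \<open>M > 0\<close> b0(2) by (simp add: abs_mult)
      qed (use b0 in auto)
      then have "e \<le> inverse M * norm x"
        using e(2)[of "\<lambda>b. inverse M * c b"] \<open>M > 0\<close> by (simp add: T_scale c)
      then have "M * e \<le> \<bar>r\<bar>" using \<open>M > 0\<close> x by (simp add: field_simps)
      then have "M \<le> R" using \<open>e > 0\<close> by (simp add: R_def field_simps)
      then show ?thesis using le[of b] \<open>R > 0\<close> by (cases "b \<in> A") (auto simp: c_def)
    qed
    have "(\<lambda>b. inverse R * c b) \<in> C"
      unfolding C_def
    proof (intro PiE_I)
      fix b
      show "inverse R * c b \<in> (if b \<in> A then {-1..1} else {0})"
        using bound[of b] \<open>R > 0\<close> by (auto simp: c_def field_simps abs_le_iff)
    qed simp
    moreover have "x = R *\<^sub>R T (\<lambda>b. inverse R * c b)"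
      using \<open>R > 0\<close> by (simp add: T_scale c)
    ultimately show "x \<in> (\<lambda>c. R *\<^sub>R T c) ` C" by blast
  qed
  moreover have "compact ((\<lambda>c. R *\<^sub>R T c) ` C)"
    by (intro compact_continuous_image compC continuous_intros contT)
  ultimately show ?thesis
    using compact_Int_closed[of "(\<lambda>c. R *\<^sub>R T c) ` C" "cball 0 r"]
    by (simp add: inf.absorb2)
qed

text \<open>If \<open>y\<close> is missed by \<open>f\<close>, it has distance at least \<open>d > 0\<close> from the closed image. Since \<open>f\<close> preserves
  distances, any two members of the orbit of \<open>y\<close> are then at least \<open>d\<close> apart, which contradicts
  sequential compactness.\<close>

lemma isometry_compact_surj:
  fixes f :: "'a::metric_space \<Rightarrow> 'a"
  assumes K: "compact K" and into: "f ` K \<subseteq> K"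
    and iso: "\<And>x y. x \<in> K \<Longrightarrow> y \<in> K \<Longrightarrow> dist (f x) (f y) = dist x y"
  shows "f ` K = K"
proof (rule ccontr)
  assume "f ` K \<noteq> K"
  then obtain y where y: "y \<in> K" "y \<notin> f ` K" using into by blast
  have "continuous_on K f"
    unfolding continuous_on_iff using iso by metis
  then have "closed (f ` K)"
    using K compact_continuous_image compact_imp_closed by blast
  then have "open (- f ` K)" by blast
  then obtain d where d: "d > 0" "\<And>z. z \<in> f ` K \<Longrightarrow> d \<le> dist y z"
    using y(2) unfolding open_contains_ball by (metis ComplI Compl_iff mem_ball not_le subset_iff)
  define s where "s n = (f ^^ n) y" for n
  have sK: "s n \<in> K" for n
    by (induction n) (use y into in \<open>auto simp: s_def\<close>)
  have shift: "dist (s (n + i)) (s (n + j)) = dist (s i) (s j)" for n i j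
    by (induction n) (use iso sK in \<open>auto simp: s_def\<close>)
  have far: "d \<le> dist (s m) (s n)" if "m < n" for m n
  proof -
    have "s (n - m) \<in> f ` K"
      using that sK[of "n - m - 1"] by (cases "n - m") (auto simp: s_def)
    then have "d \<le> dist (s 0) (s (n - m))" using d(2) by (simp add: s_def)
    also have "\<dots> = dist (s m) (s n)" using shift[of m 0 "n - m"] that by simp
    finally show ?thesis .
  qed
  obtain l r where r: "strict_mono r" "(s \<circ> r) \<longlonglongrightarrow> l"
    using K sK unfolding compact_eq_seq_compact_metric seq_compact_def by metis
  then have "Cauchy (s \<circ> r)" using LIMSEQ_imp_Cauchy by blast
  then obtain N where "\<And>m n. m \<ge> N \<Longrightarrow> n \<ge> N \<Longrightarrow> dist ((s \<circ> r) m) ((s \<circ> r) n) < d"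
    using d(1) unfolding Cauchy_def by metis
  then have "dist (s (r N)) (s (r (Suc N))) < d" by force
  moreover have "r N < r (Suc N)" using r(1) by (simp add: strict_mono_Suc_iff)
  ultimately show False using far[of "r N" "r (Suc N)"] by simp
qed

text \<open>After a translation the isometry fixes the origin, hence maps each ball around the origin into
  itself, and these balls are compact.\<close>

lemma isometry_surj_finite_span:
  fixes f :: "'a::real_normed_vector \<Rightarrow> 'a"
  assumes "finite B" "span B = (UNIV :: 'a set)"
    and iso: "\<And>x y. dist (f x) (f y) = dist x y"
  shows "surj f"
proof -
  define g where "g x = f x - f 0" for x
  have g: "dist (g x) (g y) = dist x y" for x y
    using iso[of x y] by (simp add: g_def dist_norm)
  have "y \<in> range f" for y
  proof -
    let ?K = "cball 0 (norm (y - f 0))"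
    have "g ` ?K \<subseteq> ?K"
    proof
      fix z assume "z \<in> g ` ?K"
      then obtain x where "z = g x" "x \<in> ?K" by blast
      then show "z \<in> ?K" using g[of x 0] by (simp add: g_def dist_norm norm_minus_commute)
    qed
    then have "g ` ?K = ?K"
      using isometry_compact_surj[OF compact_cball_finite_span[OF assms(1,2)]] g by blast
    then obtain x where "y - f 0 = g x" by (metis imageE mem_cball_0 order_refl)
    then show ?thesis by (auto simp: g_def)
  qed
  then show ?thesis by blast
qed

text \<open>The main step of the Mazur--Ulam theorem, by Nica's argument. Let the defect of \<open>f\<close> be the distance
  between the image of the midpoint of \<open>a\<close> and \<open>b\<close> and the midpoint of their images. The triangle
  inequality bounds it by half of \<open>dist a b\<close>, uniformly in \<open>f\<close>. Conjugating by \<open>f\<close> the point reflection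
  that swaps \<open>f a\<close> and \<open>f b\<close> gives a surjective isometry that swaps \<open>a\<close> and \<open>b\<close> and has twice the
  defect of \<open>f\<close>. Iterating this, the defect must vanish.\<close>

lemma surj_isometry_midpoint:
  fixes f :: "'a::real_normed_vector \<Rightarrow> 'a"
  assumes "\<And>x y. dist (f x) (f y) = dist x y" and "surj f"
  shows "f (midpoint a b) = midpoint (f a) (f b)"
proof -
  have doubling: "2 ^ n * dist (f (midpoint a b)) (midpoint (f a) (f b)) \<le> dist a b / 2"
    if "\<And>x y. dist (f x) (f y) = dist x y" "surj f" for n and f :: "'a \<Rightarrow> 'a"
    using that
  proof (induction n arbitrary: f)
    case 0
    have "2 * dist (f (midpoint a b)) (midpoint (f a) (f b))
        = norm ((f (midpoint a b) - f a) + (f (midpoint a b) - f b))"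
    proof -
      have "(f (midpoint a b) - f a) + (f (midpoint a b) - f b)
          = 2 *\<^sub>R (f (midpoint a b) - midpoint (f a) (f b))"
        by (simp add: midpoint_def algebra_simps scaleR_2)
      then show ?thesis by (simp add: dist_norm)
    qed
    also have "\<dots> \<le> dist (f (midpoint a b)) (f a) + dist (f (midpoint a b)) (f b)"
      unfolding dist_norm by (rule norm_triangle_ineq)
    also have "\<dots> = dist a b" by (simp add: 0 dist_midpoint)
    finally show ?case by simp
  next
    case (Suc n)
    have "inj f" using Suc.prems(1) by (metis dist_eq_0_iff injI)
    define g where "g = inv f"
    have fg: "f (g x) = x" for x using Suc.prems(2) by (simp add: g_def surj_f_inv_f)
    have gf: "g (f x) = x" for x using \<open>inj f\<close> by (simp add: g_def)
    have g: "dist (g x) (g y) = dist x y" for x y by (metis Suc.prems(1) fg)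
    define h where "h x = g (f a + f b - f x)" for x
    have hh: "h (h x) = x" for x by (simp add: h_def fg gf)
    have h: "dist (h x) (h y) = dist x y" for x y
      using Suc.prems(1)[of x y] by (simp add: h_def g) (simp add: dist_norm norm_minus_commute)
    have "surj h" using hh by (metis surjI)
    have hab: "h a = b" "h b = a" by (simp_all add: h_def gf)
    have "dist (h (midpoint a b)) (midpoint (h a) (h b))
        = dist (f a + f b - f (midpoint a b)) (f (midpoint a b))"
      by (metis hab Suc.prems(1) fg h_def midpoint_sym)
    also have "\<dots> = 2 * dist (f (midpoint a b)) (midpoint (f a) (f b))"
    proof -
      have "f a + f b - f (midpoint a b) - f (midpoint a b)
          = 2 *\<^sub>R (midpoint (f a) (f b) - f (midpoint a b))"
        by (simp add: midpoint_def algebra_simps scaleR_2)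
      then show ?thesis by (simp add: dist_norm norm_minus_commute)
    qed
    finally show ?case using Suc.IH[OF h \<open>surj h\<close>] by (simp add: ac_simps)
  qed
  show ?thesis
  proof (rule ccontr)
    assume "f (midpoint a b) \<noteq> midpoint (f a) (f b)"
    then have pos: "dist (f (midpoint a b)) (midpoint (f a) (f b)) > 0" by simp
    then obtain n where "dist a b / 2 < real n * dist (f (midpoint a b)) (midpoint (f a) (f b))"
      using reals_Archimedean3 by blast
    also have "\<dots> \<le> 2 ^ n * dist (f (midpoint a b)) (midpoint (f a) (f b))"
      using pos by (intro mult_right_mono) (simp_all add: less_imp_le)
    finally show False using doubling[OF assms, of n] by simp
  qed
qed

text \<open>Additivity gives homogeneity for integer factors. For real \<open>c\<close>, let \<open>r\<close> be the fractional part of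
  \<open>n * c\<close>. Then \<open>n\<close> times the failure of homogeneity at \<open>c\<close> is the failure at \<open>r\<close>, which is bounded
  independently of \<open>n\<close>.\<close>

lemma linear_additive_nonexpansive:
  fixes g :: "'a::real_normed_vector \<Rightarrow> 'b::real_normed_vector"
  assumes add: "\<And>x y. g (x + y) = g x + g y" and le: "\<And>x. norm (g x) \<le> norm x"
  shows "linear g"
proof (rule linearI)
  have nat: "g (real n *\<^sub>R x) = real n *\<^sub>R g x" for n x
  proof (induction n)
    case 0
    show ?case using add[of 0 0] by simp
  next
    case (Suc n)
    then show ?case by (simp add: add scaleR_left_distrib)
  qed
  have diff: "g (x - y) = g x - g y" for x y using add[of "x - y" y] by simp
  have g0: "g 0 = 0" using add[of 0 0] by simp
  have int: "g (of_int k *\<^sub>R x) = of_int k *\<^sub>R g x" for k x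
    using diff[of 0] g0 by (cases k rule: int_cases2) (simp_all add: nat)
  fix c :: real and x
  let ?d = "norm (g (c *\<^sub>R x) - c *\<^sub>R g x)"
  have bound: "real n * ?d \<le> 2 * norm x" for n
  proof -
    define r where "r = real n * c - of_int \<lfloor>real n * c\<rfloor>"
    have r: "0 \<le> r" "r \<le> 1" unfolding r_def by linarith+
    have "real n *\<^sub>R (g (c *\<^sub>R x) - c *\<^sub>R g x) = g (r *\<^sub>R x) - r *\<^sub>R g x"
      using nat[of n "c *\<^sub>R x"] by (simp add: r_def scaleR_diff_left diff int scaleR_diff_right)
    then have "real n * ?d = norm (g (r *\<^sub>R x) - r *\<^sub>R g x)"
      by (metis (no_types) abs_of_nat norm_scaleR)
    also have "\<dots> \<le> norm (r *\<^sub>R x) + norm (r *\<^sub>R g x)"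
      by (rule order_trans[OF norm_triangle_ineq4 add_right_mono[OF le]])
    also have "\<dots> = r * (norm x + norm (g x))" using r(1) by (simp add: distrib_left)
    also have "\<dots> \<le> 1 * (norm x + norm (g x))" by (intro mult_right_mono r) simp
    also have "\<dots> \<le> norm x + norm x" using le[of x] by simp
    finally show ?thesis by simp
  qed
  have "?d = 0"
  proof (rule ccontr)
    assume "?d \<noteq> 0"
    then have "?d > 0" by simp
    then obtain n where "2 * norm x < real n * ?d" using reals_Archimedean3 by blast
    then show False using bound[of n] by simp
  qed
  then show "g (c *\<^sub>R x) = c *\<^sub>R g x" by simp
qed (rule add)

text \<open>Preservation of midpoints makes \<open>\<lambda>x. f x - f 0\<close> additive, because \<open>midpoint x y\<close> is also the midpoint
  of \<open>x + y\<close> and \<open>0\<close>.\<close>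

lemma isometry_affine:
  fixes f :: "'a::real_normed_vector \<Rightarrow> 'a"
  assumes "finite B" "span B = (UNIV :: 'a set)"
    and iso: "\<And>x y. dist (f x) (f y) = dist x y"
  shows "linear (\<lambda>x. f x - f 0)"
proof (rule linear_additive_nonexpansive)
  fix x y :: 'a
  have mid: "f (midpoint a b) = midpoint (f a) (f b)" for a b
    using surj_isometry_midpoint[OF iso isometry_surj_finite_span[OF assms]] .
  have "midpoint (f (x + y)) (f 0) = midpoint (f x) (f y)"
    using mid[of x y] mid[of "x + y" 0] by (simp add: midpoint_def)
  then have "f (x + y) + f 0 = f x + f y" unfolding midpoint_def by (simp del: scaleR_add_right)
  then show "f (x + y) - f 0 = f x - f 0 + (f y - f 0)"
    by (simp add: algebra_simps)
next
  fix x show "norm (f x - f 0) \<le> norm x" using iso[of x 0] by (simp add: dist_norm)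
qed

text \<open>An infinitesimal rigid motion is the pointwise limit of the difference quotients of a rigid motion;
  these are affine because each isometry is.\<close>

lemma infinitesimal_rigid_motion_affine:
  fixes \<gamma> :: "'a::real_normed_vector \<Rightarrow> 'a"
  assumes "finite B" "span B = (UNIV :: 'a set)" and "infinitesimal_rigid_motion \<gamma>"
  shows "linear (\<lambda>x. \<gamma> x - \<gamma> 0)"
proof -
  obtain \<Gamma> where "continuous_rigid_motion \<Gamma>"
    and deriv: "\<And>x. (\<Gamma> x has_vector_derivative \<gamma> x) (at 0 within {-1..1})"
    using assms(3) unfolding infinitesimal_rigid_motion_def by blast
  then have iso: "\<And>t x y. t \<in> {-1..1} \<Longrightarrow> dist (\<Gamma> x t) (\<Gamma> y t) = dist x y"
    and start: "\<And>x. \<Gamma> x 0 = x"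
    unfolding continuous_rigid_motion_def by blast+
  define F where "F = at (0::real) within {-1..1}"
  define q where "q x t = (1 / t) *\<^sub>R ((\<Gamma> x t - \<Gamma> 0 t) - x)" for x t
  have "at (0::real) within {-1<..<1} \<le> F"
    unfolding F_def by (rule at_le) auto
  moreover have "at (0::real) within {-1<..<1} = at 0"
    by (rule at_within_open) auto
  ultimately have F: "F \<noteq> bot"
    using at_neq_bot[of "0::real"] by (auto simp: bot.extremum_unique)
  have ev: "\<forall>\<^sub>F t in F. t \<in> {-1..1}" unfolding F_def by (simp add: eventually_at_filter)
  \<comment> \<open>Differentiability controls the remainder divided by \<open>norm t\<close>. Dividing by \<open>t\<close> instead changes it
    by a sign only, so both quotients tend to 0.\<close>
  have lim: "((\<lambda>t. (1 / t) *\<^sub>R (\<Gamma> x t - x)) \<longlongrightarrow> \<gamma> x) F" for x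
  proof -
    have "((\<lambda>t. (1 / norm (t - 0)) *\<^sub>R (\<Gamma> x t - (\<Gamma> x 0 + (t - 0) *\<^sub>R \<gamma> x))) \<longlongrightarrow> 0) F"
      using deriv[of x] unfolding has_vector_derivative_def has_derivative_within F_def by (rule conjunct2)
    then have "((\<lambda>t. norm ((1 / norm (t - 0)) *\<^sub>R (\<Gamma> x t - (\<Gamma> x 0 + (t - 0) *\<^sub>R \<gamma> x)))) \<longlongrightarrow> 0) F"
      by (rule tendsto_norm_zero)
    moreover have "\<forall>\<^sub>F t in F. norm ((1 / norm (t - 0)) *\<^sub>R (\<Gamma> x t - (\<Gamma> x 0 + (t - 0) *\<^sub>R \<gamma> x)))
        = norm ((1 / t) *\<^sub>R (\<Gamma> x t - x) - \<gamma> x)"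
      unfolding F_def eventually_at_filter
    proof (rule always_eventually, intro allI impI)
      fix t :: real assume "t \<noteq> 0"
      then have "(1 / t) *\<^sub>R (\<Gamma> x t - x) - \<gamma> x = (1 / t) *\<^sub>R (\<Gamma> x t - (\<Gamma> x 0 + (t - 0) *\<^sub>R \<gamma> x))"
        by (simp add: start scaleR_diff_right scaleR_add_right)
      then show "norm ((1 / norm (t - 0)) *\<^sub>R (\<Gamma> x t - (\<Gamma> x 0 + (t - 0) *\<^sub>R \<gamma> x)))
        = norm ((1 / t) *\<^sub>R (\<Gamma> x t - x) - \<gamma> x)" by simp
    qed
    ultimately have "((\<lambda>t. norm ((1 / t) *\<^sub>R (\<Gamma> x t - x) - \<gamma> x)) \<longlongrightarrow> 0) F"
      by (rule Lim_transform_eventually)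
    then have "((\<lambda>t. (1 / t) *\<^sub>R (\<Gamma> x t - x) - \<gamma> x) \<longlongrightarrow> 0) F"
      by (rule tendsto_norm_zero_cancel)
    then show ?thesis by (simp only: Lim_null[symmetric])
  qed
  have "q x = (\<lambda>t. (1 / t) *\<^sub>R (\<Gamma> x t - x) - (1 / t) *\<^sub>R (\<Gamma> 0 t - 0))" for x
    unfolding q_def by (rule ext) (simp add: scaleR_diff_right)
  then have q: "(q x \<longlongrightarrow> \<gamma> x - \<gamma> 0) F" for x
    using tendsto_diff[OF lim[of x] lim[of 0]] by (simp only:)
  have lin: "linear (\<lambda>x. \<Gamma> x t - \<Gamma> 0 t)" if "t \<in> {-1..1}" for t
    by (rule isometry_affine[OF assms(1,2)]) (rule iso[OF that])
  have qlin: "linear (\<lambda>x. q x t)" if "t \<in> {-1..1}" for t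
    unfolding q_def using linear_compose_scale_right[OF linear_compose_sub[OF lin[OF that] linear_ident]] .
  show ?thesis
  proof (rule linearI)
    fix x y
    have "\<forall>\<^sub>F t in F. q (x + y) t = q x t + q y t"
      using ev by (rule eventually_mono) (rule linear_add[OF qlin])
    then have "((\<lambda>t. q x t + q y t) \<longlongrightarrow> \<gamma> (x + y) - \<gamma> 0) F"
      using q[of "x + y"] by (rule Lim_transform_eventually[rotated])
    then show "\<gamma> (x + y) - \<gamma> 0 = \<gamma> x - \<gamma> 0 + (\<gamma> y - \<gamma> 0)"
      by (rule tendsto_unique[OF F _ tendsto_add[OF q q]])
  next
    fix c x
    have "\<forall>\<^sub>F t in F. q (c *\<^sub>R x) t = c *\<^sub>R q x t"
      using ev by (rule eventually_mono) (rule linear_scale[OF qlin])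
    then have "((\<lambda>t. c *\<^sub>R q x t) \<longlongrightarrow> \<gamma> (c *\<^sub>R x) - \<gamma> 0) F"
      using q[of "c *\<^sub>R x"] by (rule Lim_transform_eventually[rotated])
    then show "\<gamma> (c *\<^sub>R x) - \<gamma> 0 = c *\<^sub>R (\<gamma> x - \<gamma> 0)"
      by (rule tendsto_unique[OF F _ tendsto_scaleR[OF tendsto_const q]])
  qed
qed


section \<open>Flex cancellation implies rigidity\<close>

lemma infinitesimal_flex_restrict:
  assumes "subframework H q G p" and "infinitesimal_flex G p u'"
    and "\<And>v. v \<in> verts H \<Longrightarrow> u' v = u v"
  shows "infinitesimal_flex H q u"
  unfolding infinitesimal_flex_def
proof (intro allI impI)
  fix v w assume e: "{v, w} \<in> edges H"
  have "subgraph H G" and qp: "\<And>v. v \<in> verts H \<Longrightarrow> q v = p v"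
    using assms(1) by (auto simp: subframework_def)
  then have v: "v \<in> verts H" and w: "w \<in> verts H" and e': "{v, w} \<in> edges G"
    using e by (auto simp: subgraph_def simple_graph_def)
  then show "(\<lambda>t. norm (q v + t *\<^sub>R u v - (q w + t *\<^sub>R u w)) - norm (q v - q w)) \<in> o[at 0](\<lambda>t. t)"
    using assms(2)[unfolded infinitesimal_flex_def, rule_format, OF e']
    by (simp only: assms(3)[OF v] assms(3)[OF w] qp[OF v] qp[OF w])
qed

text \<open>By cancellation, a flex \<open>u\<close> of the whole framework agrees on each stage \<open>k\<close> with some infinitesimal
  rigid motion \<open>\<gamma> k\<close>. In finite dimension the affine span of all joints is already spanned by the joints
  of one finite stage \<open>K\<close>. As the \<open>\<gamma> k\<close> are affine, each later \<open>\<gamma> m\<close> agrees with \<open>\<gamma> K\<close> on that span, so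
  \<open>\<gamma> K\<close> alone induces \<open>u\<close> at every joint.\<close>

lemma flex_cancellation_imp_rigid:
  fixes p :: "'v \<Rightarrow> 'a::real_normed_vector"
  assumes "finite B" and span: "span B = (UNIV :: 'a set)"
    and ct: "contains_tower G p Gs ps" and vc: "vertex_complete G Gs"
    and fc: "flex_cancellation Gs ps"
  shows "infinitesimally_rigid G p"
  unfolding infinitesimally_rigid_def
proof (intro allI impI)
  fix u assume u: "infinitesimal_flex G p u"
  have sub: "subframework (Gs k) (ps k) G p" for k
    using ct by (simp add: contains_tower_def)
  have ps: "ps k v = p v" if "v \<in> verts (Gs k)" for k v
    using sub[of k] that by (simp add: subframework_def)
  have "verts (Gs k) \<subseteq> verts (Gs (Suc k))" for k
    using ct by (simp add: contains_tower_def tower_def subframework_def subgraph_def)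
  then have mono: "verts (Gs k) \<subseteq> verts (Gs m)" if "k \<le> m" for k m
    using that lift_Suc_mono_le[of "\<lambda>k. verts (Gs k)"] by blast
  have flex: "infinitesimal_flex (Gs k) (ps k) u" for k
    using infinitesimal_flex_restrict[OF sub u] by simp
  have "trivial_flex (Gs k) (ps k) u" for k
  proof (rule ccontr)
    assume "\<not> trivial_flex (Gs k) (ps k) u"
    then have "nontrivial_flex (Gs k) (ps k) u" using flex by (simp add: nontrivial_flex_def)
    then obtain m where "\<not> extends_to_flex (Gs k) u (Gs m) (ps m)"
      using fc unfolding flex_cancellation_def by blast
    then show False using flex[of m] unfolding extends_to_flex_def by blast
  qed
  then have "\<exists>\<gamma>. infinitesimal_rigid_motion \<gamma> \<and> (\<forall>v\<in>verts (Gs k). u v = \<gamma> (p v))" for k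
    using ps[of _ k] unfolding trivial_flex_def by metis
  then obtain \<gamma> where rm: "\<And>k. infinitesimal_rigid_motion (\<gamma> k)"
    and \<gamma>: "\<And>k v. v \<in> verts (Gs k) \<Longrightarrow> u v = \<gamma> k (p v)"
    by metis
  define L where "L k x = \<gamma> k x - \<gamma> k 0" for k x
  have lin: "linear (L k)" for k
    unfolding L_def by (rule infinitesimal_rigid_motion_affine[OF assms(1,2) rm])
  have vG: "verts G = (\<Union>k. verts (Gs k))" using vc by (simp add: vertex_complete_def)
  have "\<exists>K. \<forall>v\<in>verts G. u v = \<gamma> K (p v)"
  proof (cases "verts G = {}")
    case False
    then obtain v0 k0 where v0: "v0 \<in> verts (Gs k0)" using vG by blast
    have L: "L k (p v - p v0) = u v - u v0" if "v \<in> verts (Gs k)" "v0 \<in> verts (Gs k)" for k v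
      using linear_diff[OF lin[of k], of "p v" "p v0"] \<gamma>[OF that(1)] \<gamma>[OF that(2)]
      by (simp add: L_def)
    obtain A where A: "A \<subseteq> (\<lambda>v. p v - p v0) ` verts G" "independent A"
      "(\<lambda>v. p v - p v0) ` verts G \<subseteq> span A"
      using maximal_independent_subset[of "(\<lambda>v. p v - p v0) ` verts G"] by metis
    have "finite A" using independent_span_bound[OF assms(1) A(2)] span by simp
    moreover have "\<forall>a\<in>A. \<exists>k. a \<in> (\<lambda>v. p v - p v0) ` verts (Gs k)" using A(1) vG by blast
    then obtain f where f: "\<And>a. a \<in> A \<Longrightarrow> a \<in> (\<lambda>v. p v - p v0) ` verts (Gs (f a))" by metis
    define K where "K = Max (insert k0 (f ` A))"
    have K: "k0 \<le> K" "\<And>a. a \<in> A \<Longrightarrow> f a \<le> K" using \<open>finite A\<close> by (simp_all add: K_def)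
    have AK: "a \<in> (\<lambda>v. p v - p v0) ` verts (Gs K)" if "a \<in> A" for a
      using f[OF that] mono[OF K(2)[OF that]] by blast
    have "u v = \<gamma> K (p v)" if "v \<in> verts G" for v
    proof -
      obtain m' where "v \<in> verts (Gs m')" using \<open>v \<in> verts G\<close> vG by blast
      define m where "m = max m' K"
      have m: "v \<in> verts (Gs m)" "K \<le> m"
        using \<open>v \<in> verts (Gs m')\<close> mono[of m' m] by (auto simp: m_def)
      have v0K: "v0 \<in> verts (Gs K)" "v0 \<in> verts (Gs m)"
        using v0 mono[of k0 K] mono[of k0 m] K(1) m(2) by auto
      have "L K a = L m a" if a: "a \<in> A" for a
      proof -
        obtain w where w: "w \<in> verts (Gs K)" "a = p w - p v0" using AK[OF a] by blast
        then show ?thesis using L[of w K] L[of w m] v0K mono[OF m(2)] by auto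
      qed
      moreover have "p v - p v0 \<in> span A" using A(3) \<open>v \<in> verts G\<close> by blast
      ultimately have "L K (p v - p v0) = L m (p v - p v0)"
        using linear_eq_on[OF lin lin] by blast
      also have "\<dots> = u v - u v0" using L m(1) v0K(2) by blast
      finally have "L K (p v) - L K (p v0) = u v - u v0"
        using linear_diff[OF lin] by metis
      then show ?thesis using \<gamma>[OF v0K(1)] by (simp add: L_def)
    qed
    then show ?thesis by blast
  qed simp
  then show "trivial_flex G p u" using u rm unfolding trivial_flex_def by blast
qed

lemma relatively_rigid_imp_flex_cancellation:
  assumes "relatively_rigid_tower Gs ps"
  shows "flex_cancellation Gs ps"
  using assms unfolding relatively_rigid_tower_def relatively_infinitesimally_rigid_def
    flex_cancellation_def by blast

section \<open>Linearity of the space of flexes\<close>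

text \<open>The first-order condition that a flex imposes on one bar: \<open>x\<close> is the bar and \<open>d\<close> the relative velocity
  of its ends.\<close>

definition norm_stationary :: "'a::real_normed_vector \<Rightarrow> 'a \<Rightarrow> bool" where
  "norm_stationary x d \<longleftrightarrow> (\<lambda>t. norm (x + t *\<^sub>R d) - norm x) \<in> o[at 0](\<lambda>t. t)"

lemma norm_stationary_iff:
  "norm_stationary x d \<longleftrightarrow>
     (\<forall>c>0. \<exists>\<delta>>0. \<forall>t. \<bar>t\<bar> < \<delta> \<longrightarrow> \<bar>norm (x + t *\<^sub>R d) - norm x\<bar> \<le> c * \<bar>t\<bar>)"
proof
  assume st: "norm_stationary x d"
  show "\<forall>c>0. \<exists>\<delta>>0. \<forall>t. \<bar>t\<bar> < \<delta> \<longrightarrow> \<bar>norm (x + t *\<^sub>R d) - norm x\<bar> \<le> c * \<bar>t\<bar>"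
  proof (intro allI impI)
    fix c :: real assume "c > 0"
    then have "\<forall>\<^sub>F t in at 0. norm (norm (x + t *\<^sub>R d) - norm x) \<le> c * norm t"
      using landau_o.smallD[OF st[unfolded norm_stationary_def]] by blast
    then obtain \<delta> where \<delta>: "\<delta> > 0"
      "\<And>t. t \<noteq> 0 \<Longrightarrow> \<bar>t\<bar> < \<delta> \<Longrightarrow> \<bar>norm (x + t *\<^sub>R d) - norm x\<bar> \<le> c * \<bar>t\<bar>"
      unfolding eventually_at by (auto simp: dist_norm)
    have "\<bar>norm (x + t *\<^sub>R d) - norm x\<bar> \<le> c * \<bar>t\<bar>" if "\<bar>t\<bar> < \<delta>" for t
      using \<delta>(2)[of t] that by (cases "t = 0") auto
    then show "\<exists>\<delta>>0. \<forall>t. \<bar>t\<bar> < \<delta> \<longrightarrow> \<bar>norm (x + t *\<^sub>R d) - norm x\<bar> \<le> c * \<bar>t\<bar>"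
      using \<delta>(1) by blast
  qed
next
  assume *: "\<forall>c>0. \<exists>\<delta>>0. \<forall>t. \<bar>t\<bar> < \<delta> \<longrightarrow> \<bar>norm (x + t *\<^sub>R d) - norm x\<bar> \<le> c * \<bar>t\<bar>"
  show "norm_stationary x d"
    unfolding norm_stationary_def
  proof (rule landau_o.smallI)
    fix c :: real assume "c > 0"
    then obtain \<delta> where "\<delta> > 0" "\<And>t. \<bar>t\<bar> < \<delta> \<Longrightarrow> \<bar>norm (x + t *\<^sub>R d) - norm x\<bar> \<le> c * \<bar>t\<bar>"
      using * by blast
    then show "\<forall>\<^sub>F t in at 0. norm (norm (x + t *\<^sub>R d) - norm x) \<le> c * norm t"
      unfolding eventually_at by (intro exI[of _ \<delta>]) (auto simp: dist_norm)
  qed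
qed

lemma norm_stationary_scale:
  assumes "norm_stationary x d"
  shows "norm_stationary x (a *\<^sub>R d)"
  unfolding norm_stationary_iff
proof (intro allI impI)
  fix c :: real assume "c > 0"
  define k where "k = \<bar>a\<bar> + 1"
  have k: "k > 0" "\<bar>a\<bar> \<le> k" by (auto simp: k_def)
  then have "c / k > 0" using \<open>c > 0\<close> by simp
  then obtain \<delta> where \<delta>: "\<delta> > 0"
    "\<And>t. \<bar>t\<bar> < \<delta> \<Longrightarrow> \<bar>norm (x + t *\<^sub>R d) - norm x\<bar> \<le> c / k * \<bar>t\<bar>"
    using assms unfolding norm_stationary_iff by blast
  have "\<bar>norm (x + t *\<^sub>R a *\<^sub>R d) - norm x\<bar> \<le> c * \<bar>t\<bar>" if "\<bar>t\<bar> < \<delta> / k" for t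
  proof -
    have at: "\<bar>t * a\<bar> \<le> k * \<bar>t\<bar>"
      using mult_right_mono[OF k(2), of "\<bar>t\<bar>"] by (simp add: abs_mult ac_simps)
    also have "k * \<bar>t\<bar> < \<delta>" using that k(1) by (simp add: field_simps)
    finally have "\<bar>norm (x + (t * a) *\<^sub>R d) - norm x\<bar> \<le> c / k * \<bar>t * a\<bar>" by (rule \<delta>(2))
    also have "\<dots> \<le> c / k * (k * \<bar>t\<bar>)" using at \<open>c / k > 0\<close> by (intro mult_left_mono) auto
    finally show ?thesis using k(1) by simp
  qed
  then show "\<exists>\<delta>>0. \<forall>t. \<bar>t\<bar> < \<delta> \<longrightarrow> \<bar>norm (x + t *\<^sub>R a *\<^sub>R d) - norm x\<bar> \<le> c * \<bar>t\<bar>"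
    using \<delta>(1) k(1) by (intro exI[of _ "\<delta> / k"]) simp
qed

text \<open>The norm need not be differentiable, so linearity of the derivative is replaced by convexity.
  Writing \<open>x + t *\<^sub>R (d + e)\<close> as the midpoint of \<open>x + (2 * t) *\<^sub>R d\<close> and \<open>x + (2 * t) *\<^sub>R e\<close>
  bounds the growth of the norm from above. Since \<open>x\<close> is the midpoint of the points with parameters
  \<open>t\<close> and \<open>- t\<close>, the upper bound at \<open>- t\<close> yields the lower bound at \<open>t\<close>.\<close>

lemma norm_stationary_add:
  assumes "norm_stationary x d" and "norm_stationary x e"
  shows "norm_stationary x (d + e)"
  unfolding norm_stationary_iff
proof (intro allI impI)
  fix c :: real assume "c > 0"
  then have c2: "c / 2 > 0" by simp
  obtain \<delta> where \<delta>: "\<delta> > 0"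
    "\<And>t. \<bar>t\<bar> < \<delta> \<Longrightarrow> \<bar>norm (x + t *\<^sub>R d) - norm x\<bar> \<le> c / 2 * \<bar>t\<bar>"
    using assms(1) c2 unfolding norm_stationary_iff by blast
  obtain \<eta> where \<eta>: "\<eta> > 0"
    "\<And>t. \<bar>t\<bar> < \<eta> \<Longrightarrow> \<bar>norm (x + t *\<^sub>R e) - norm x\<bar> \<le> c / 2 * \<bar>t\<bar>"
    using assms(2) c2 unfolding norm_stationary_iff by blast
  have upper: "norm (x + t *\<^sub>R (d + e)) \<le> norm x + c * \<bar>t\<bar>" if "\<bar>t\<bar> < min \<delta> \<eta> / 2" for t
  proof -
    have "2 *\<^sub>R (x + t *\<^sub>R (d + e)) = (x + (2 * t) *\<^sub>R d) + (x + (2 * t) *\<^sub>R e)"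
      by (simp add: algebra_simps scaleR_2)
    then have "2 * norm (x + t *\<^sub>R (d + e)) = norm ((x + (2 * t) *\<^sub>R d) + (x + (2 * t) *\<^sub>R e))"
      by (metis abs_numeral norm_scaleR)
    also have "\<dots> \<le> norm (x + (2 * t) *\<^sub>R d) + norm (x + (2 * t) *\<^sub>R e)"
      by (rule norm_triangle_ineq)
    also have "\<dots> \<le> (norm x + c * \<bar>t\<bar>) + (norm x + c * \<bar>t\<bar>)"
      using \<delta>(2)[of "2 * t"] \<eta>(2)[of "2 * t"] that by (intro add_mono) (auto simp: abs_mult)
    finally show ?thesis by simp
  qed
  have "\<bar>norm (x + t *\<^sub>R (d + e)) - norm x\<bar> \<le> c * \<bar>t\<bar>" if t: "\<bar>t\<bar> < min \<delta> \<eta> / 2" for t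
  proof -
    have "2 *\<^sub>R x = (x + t *\<^sub>R (d + e)) + (x + (- t) *\<^sub>R (d + e))"
      by (simp add: scaleR_2)
    then have "2 * norm x \<le> norm (x + t *\<^sub>R (d + e)) + norm (x + (- t) *\<^sub>R (d + e))"
      by (metis abs_numeral norm_scaleR norm_triangle_ineq)
    then show ?thesis using upper[OF t] upper[of "- t"] t by auto
  qed
  then show "\<exists>\<delta>>0. \<forall>t. \<bar>t\<bar> < \<delta> \<longrightarrow> \<bar>norm (x + t *\<^sub>R (d + e)) - norm x\<bar> \<le> c * \<bar>t\<bar>"
    using \<delta>(1) \<eta>(1) by (intro exI[of _ "min \<delta> \<eta> / 2"]) simp
qed

lemma infinitesimal_flex_iff_norm_stationary:
  "infinitesimal_flex G p u \<longleftrightarrow>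
     (\<forall>v w. {v, w} \<in> edges G \<longrightarrow> norm_stationary (p v - p w) (u v - u w))"
proof -
  have "p v + t *\<^sub>R u v - (p w + t *\<^sub>R u w) = (p v - p w) + t *\<^sub>R (u v - u w)" for t v w
    by (simp add: algebra_simps)
  then show ?thesis by (simp only: infinitesimal_flex_def norm_stationary_def)
qed

text \<open>A linear subspace of the space of all functions into a vector space.\<close>

definition linear_family :: "('v \<Rightarrow> 'a::real_vector) set \<Rightarrow> bool" where
  "linear_family S \<longleftrightarrow> (\<lambda>_. 0) \<in> S \<and> (\<forall>u\<in>S. \<forall>w\<in>S. \<forall>c. (\<lambda>v. u v + c *\<^sub>R w v) \<in> S)"

lemma linear_family_zero: "linear_family S \<Longrightarrow> (\<lambda>_. 0) \<in> S"
  by (simp add: linear_family_def)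

lemma linear_family_combine:
  assumes "linear_family S" and "u \<in> S" and "w \<in> S"
  shows "(\<lambda>v. u v + c *\<^sub>R w v) \<in> S"
  using assms by (simp add: linear_family_def)

lemma linear_family_flexes: "linear_family {u. infinitesimal_flex G p u}"
proof -
  have "norm_stationary x 0" for x :: 'b by (simp add: norm_stationary_def)
  moreover have "norm_stationary (p v - p w) (u v + c *\<^sub>R z v - (u w + c *\<^sub>R z w))"
    if "norm_stationary (p v - p w) (u v - u w)" "norm_stationary (p v - p w) (z v - z w)"
    for v w u z c
  proof -
    have "u v + c *\<^sub>R z v - (u w + c *\<^sub>R z w) = (u v - u w) + c *\<^sub>R (z v - z w)"
      by (simp add: algebra_simps)
    then show ?thesis
      using norm_stationary_add[OF that(1) norm_stationary_scale[OF that(2)]] by (simp only:)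
  qed
  ultimately show ?thesis
    by (simp add: linear_family_def infinitesimal_flex_iff_norm_stationary)
qed

section \<open>Stabilization of descending chains\<close>

text \<open>A member of least dimension is contained in every later member: otherwise a basis of the later one,
  enlarged by a missing vector, would be an independent set that is too large.\<close>

lemma subspace_chain_stabilizes:
  fixes S :: "nat \<Rightarrow> 'a::real_vector set"
  assumes "finite B" "span B = (UNIV :: 'a set)"
    and sub: "\<And>n. subspace (S n)" and dec: "decseq S"
  shows "\<exists>N. \<forall>n\<ge>N. S n = S N"
proof -
  obtain N where N: "\<And>n. dim (S N) \<le> dim (S n)"
    using ex_has_least_nat[of "\<lambda>_. True" 0 "\<lambda>n. dim (S n)"] by auto
  have "S N \<subseteq> S n" if "N \<le> n" for n
  proof
    fix x assume x: "x \<in> S N"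
    obtain C where C: "C \<subseteq> S n" "independent C" "S n \<subseteq> span C" "card C = dim (S n)"
      by (rule basis_exists)
    obtain D where D: "D \<subseteq> S N" "independent D" "S N \<subseteq> span D" "card D = dim (S N)"
      by (rule basis_exists)
    have fin: "finite C" "finite D"
      using independent_span_bound[OF assms(1)] C(2) D(2) assms(2) by auto
    show "x \<in> S n"
    proof (rule ccontr)
      assume "x \<notin> S n"
      then have xC: "x \<notin> span C" using span_minimal[OF C(1) sub] by blast
      then have "independent (insert x C)" using C(2) by (simp add: independent_insert)
      moreover have "insert x C \<subseteq> span D"
        using x C(1) D(3) decseqD[OF dec that] by auto
      ultimately have "card (insert x C) \<le> card D"
        using independent_span_bound[OF fin(2)] by blast
      moreover have "x \<notin> C" using xC span_base by blast
      ultimately show False using fin(1) C(4) D(4) N[of n] by simp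
    qed
  qed
  then show ?thesis using decseqD[OF dec] by (metis subset_antisym)
qed

text \<open>The restrictions of the families to a finite set \<open>V\<close> lie in a finite-dimensional space, so they
  stabilize. By induction on \<open>V\<close> this reduces to chains of subspaces of the target: adding a point \<open>x\<close>,
  split each family into its values at \<open>x\<close> and its members that vanish at \<open>x\<close>. Once both chains are
  constant, match the value at \<open>x\<close> first and correct the difference by a function vanishing at \<open>x\<close>.\<close>

lemma linear_family_chain_stabilizes:
  fixes S :: "nat \<Rightarrow> ('v \<Rightarrow> 'a::real_vector) set"
  assumes B: "finite B" "span B = (UNIV :: 'a set)" and "finite V"
    and "\<And>n. linear_family (S n)" and "decseq S"
  shows "\<exists>N. \<forall>n\<ge>N. \<forall>u\<in>S N. \<exists>w\<in>S n. \<forall>v\<in>V. w v = u v"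
  using \<open>finite V\<close> assms(4,5)
proof (induction V arbitrary: S)
  case empty
  have zero: "(\<lambda>_. 0) \<in> S n" for n by (rule linear_family_zero[OF empty(1)])
  show ?case by (intro exI[of _ 0] allI impI ballI bexI[OF _ zero]) simp
next
  case (insert x V)
  have lin: "(\<lambda>v. u v + c *\<^sub>R w v) \<in> S n" if "u \<in> S n" "w \<in> S n" for n u w c
    by (rule linear_family_combine[OF insert.prems(1) that])
  have zero: "(\<lambda>_. 0) \<in> S n" for n by (rule linear_family_zero[OF insert.prems(1)])
  have dec: "S n \<subseteq> S m" if "m \<le> n" for m n using decseqD[OF insert.prems(2) that] .
  define K where "K n = {u \<in> S n. u x = 0}" for n
  have linK: "linear_family (K n)" for n
    unfolding linear_family_def
  proof (intro conjI ballI allI)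
    show "(\<lambda>_. 0) \<in> K n" using zero by (simp add: K_def)
    show "(\<lambda>v. u v + c *\<^sub>R w v) \<in> K n" if "u \<in> K n" "w \<in> K n" for u w c
      using that lin[of u n w c] unfolding K_def by simp
  qed
  have decK: "decseq K" unfolding decseq_def K_def using dec by auto
  obtain N1 where N1: "\<forall>n\<ge>N1. \<forall>u\<in>K N1. \<exists>w\<in>K n. \<forall>v\<in>V. w v = u v"
    using insert.IH[of K, OF linK decK] by (rule exE)
  define P where "P n = (\<lambda>u. u x) ` S n" for n
  have subP: "subspace (P n)" for n
  proof (rule subspaceI)
    show "0 \<in> P n" unfolding P_def using zero[of n] by force
    show "a + b \<in> P n" if ab: "a \<in> P n" "b \<in> P n" for a b
    proof -
      obtain u w where "u \<in> S n" "w \<in> S n" and [simp]: "a = u x" "b = w x"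
        using ab unfolding P_def by blast
      then have "(\<lambda>v. u v + 1 *\<^sub>R w v) \<in> S n" by (intro lin)
      from imageI[OF this, of "\<lambda>u. u x"] show ?thesis by (simp add: P_def)
    qed
    show "c *\<^sub>R a \<in> P n" if a: "a \<in> P n" for c a
    proof -
      obtain u where "u \<in> S n" and [simp]: "a = u x" using a unfolding P_def by blast
      then have "(\<lambda>v. 0 + c *\<^sub>R u v) \<in> S n" by (intro lin zero)
      from imageI[OF this, of "\<lambda>u. u x"] show ?thesis by (simp add: P_def)
    qed
  qed
  have decP: "decseq P" unfolding decseq_def P_def by (intro allI impI image_mono dec)
  obtain N2 where N2: "\<forall>n\<ge>N2. P n = P N2"
    using subspace_chain_stabilizes[OF B subP decP] by (rule exE)
  have "\<exists>w\<in>S n. \<forall>v\<in>insert x V. w v = u v" if n: "n \<ge> max N1 N2" and u: "u \<in> S (max N1 N2)" for n u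
  proof -
    have "u x \<in> P (max N1 N2)" using u unfolding P_def by (rule imageI)
    moreover have "P (max N1 N2) = P n"
      using N2[rule_format, of "max N1 N2"] N2[rule_format, of n] n by simp
    ultimately obtain z where z: "z \<in> S n" "z x = u x" by (auto simp: P_def)
    have lift: "\<exists>w\<in>K n. \<forall>v\<in>V. w v = g v" if "g \<in> K N1" for g
      using N1 that n by simp
    have diff: "(\<lambda>v. u v + (-1) *\<^sub>R z v) \<in> K N1"
    proof -
      have "u \<in> S N1" "z \<in> S N1"
        using dec[of N1 "max N1 N2"] dec[of N1 n] u z(1) n by auto
      then have "(\<lambda>v. u v + (-1) *\<^sub>R z v) \<in> S N1" by (rule lin)
      then show ?thesis unfolding K_def using z(2) by simp
    qed
    obtain w where w: "w \<in> K n" "\<forall>v\<in>V. w v = u v + (-1) *\<^sub>R z v"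
      using lift[OF diff] by (rule bexE)
    then have "w \<in> S n" "w x = 0" by (auto simp: K_def)
    then show ?thesis
      using z(2) w(2) by (intro bexI[OF _ lin[OF z(1) \<open>w \<in> S n\<close>, of 1]]) simp
  qed
  then show ?case by (intro exI[of _ "max N1 N2"] allI impI ballI)
qed

section \<open>Extension of flexes along an exhaustion\<close>

definition induced_subgraph :: "'v graph \<Rightarrow> 'v set \<Rightarrow> 'v graph" where
  "induced_subgraph G U = \<lparr>verts = U, edges = {e \<in> edges G. e \<subseteq> U}\<rparr>"

lemma subframework_induced:
  assumes "framework G p" and "U \<subseteq> verts G"
  shows "subframework (induced_subgraph G U) p G p"
  using assms
  by (auto simp: subframework_def framework_def subgraph_def simple_graph_def induced_subgraph_def)

lemma subframework_induced_mono:
  assumes "framework G p" and "U \<subseteq> W" and "W \<subseteq> verts G"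
  shows "subframework (induced_subgraph G U) p (induced_subgraph G W) p"
  using assms
  by (auto simp: subframework_def framework_def subgraph_def simple_graph_def induced_subgraph_def)

text \<open>A Mittag-Leffler argument. The flexes of stage \<open>k\<close> that extend to stage \<open>n\<close> form a descending chain
  in \<open>n\<close>, which is constant from some \<open>M k\<close> on. Hence a flex of stage \<open>k\<close> that extends to stage \<open>M k\<close>
  extends to every finite stage, a property called \<open>P k\<close> below. To pass from all finite stages to \<open>G\<close>
  itself, one needs coherent extensions: a flex with \<open>P k\<close> extends to stage \<open>M (Suc k)\<close>, and the
  restriction of that extension to stage \<open>Suc k\<close> again has \<open>P (Suc k)\<close>. Iterating this choice gives
  flexes of the successive stages, each extending its predecessor, whose union is a flex of \<open>G\<close>.\<close>

lemma finite_stage_extension_imp_extension: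
  fixes p :: "'v \<Rightarrow> 'a::real_normed_vector"
  assumes B: "finite B" "span B = (UNIV :: 'a set)"
    and G: "framework G p"
    and fin: "\<And>n. finite (U n)" and inc: "incseq U" and un: "verts G = (\<Union>n. U n)"
  shows "\<exists>m>k. \<forall>u. extends_to_flex (induced_subgraph G (U k)) u (induced_subgraph G (U m)) p
               \<longrightarrow> extends_to_flex (induced_subgraph G (U k)) u G p"
proof -
  define F where "F n = {u. infinitesimal_flex (induced_subgraph G (U n)) p u}" for n
  have lin: "linear_family (F n)" for n unfolding F_def by (rule linear_family_flexes)
  have UG: "U n \<subseteq> verts G" for n using un by blast
  have Umono: "U m \<subseteq> U n" if "m \<le> n" for m n using incseqD[OF inc that] .
  have Fcong: "w \<in> F m" if "u \<in> F n" "m \<le> n" "\<And>v. v \<in> U m \<Longrightarrow> u v = w v" for m n u w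
    using infinitesimal_flex_restrict[OF subframework_induced_mono[OF G Umono[OF that(2)] UG], of u w] that
    by (simp add: F_def induced_subgraph_def)
  then have dec: "decseq F" unfolding decseq_def by blast
  have "\<exists>m>j. \<forall>n\<ge>m. \<forall>u\<in>F m. \<exists>w\<in>F n. \<forall>v\<in>U j. w v = u v" for j
  proof -
    obtain N where N: "\<And>n u. n \<ge> N \<Longrightarrow> u \<in> F N \<Longrightarrow> \<exists>w\<in>F n. \<forall>v\<in>U j. w v = u v"
      using linear_family_chain_stabilizes[OF B fin lin dec] by blast
    show ?thesis
      using N decseqD[OF dec, of N "max N (Suc j)"]
      by (intro exI[of _ "max N (Suc j)"]) (auto simp del: max.absorb1 max.absorb2)
  qed
  then obtain M where M: "\<And>j. j < M j"
    "\<And>j n u. n \<ge> M j \<Longrightarrow> u \<in> F (M j) \<Longrightarrow> \<exists>w\<in>F n. \<forall>v\<in>U j. w v = u v"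
    by metis
  define P where "P j u \<longleftrightarrow> (\<forall>n. \<exists>w\<in>F n. \<forall>v\<in>U j. w v = u v)" for j u
  have PI: "P j u" if "u \<in> F (M j)" for j u
    unfolding P_def
  proof
    fix n
    show "\<exists>w\<in>F n. \<forall>v\<in>U j. w v = u v"
    proof (cases "n \<ge> M j")
      case True
      then show ?thesis using M(2) that by blast
    next
      case False
      then show ?thesis using that decseqD[OF dec, of n "M j"] by auto
    qed
  qed
  have step: "\<exists>u'. P (Suc j) u' \<and> (\<forall>v\<in>U j. u' v = u v)" if "P j u" for j u
  proof -
    obtain w where "w \<in> F (M (Suc j))" "\<forall>v\<in>U j. w v = u v"
      using \<open>P j u\<close> unfolding P_def by blast
    then show ?thesis using PI by blast
  qed
  have "extends_to_flex (induced_subgraph G (U k)) u G p"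
    if ext: "extends_to_flex (induced_subgraph G (U k)) u (induced_subgraph G (U (M k))) p" for u
  proof -
    obtain u0 where u0: "u0 \<in> F (M k)" "\<forall>v\<in>U k. u0 v = u v"
      using ext by (auto simp: extends_to_flex_def F_def induced_subgraph_def)
    have "\<exists>f. \<forall>n. P (k + n) (f n) \<and> (n = 0 \<longrightarrow> f n = u0) \<and> (\<forall>v\<in>U (k + n). f (Suc n) v = f n v)"
    proof (rule dependent_nat_choice[where P = "\<lambda>n x. P (k + n) x \<and> (n = 0 \<longrightarrow> x = u0)"
          and Q = "\<lambda>n x y. \<forall>v\<in>U (k + n). y v = x v", simplified conj_assoc])
      show "\<exists>x. P (k + 0) x \<and> (0 = 0 \<longrightarrow> x = u0)" using PI[OF u0(1)] by simp
      show "\<exists>y. P (k + Suc n) y \<and> (Suc n = 0 \<longrightarrow> y = u0) \<and> (\<forall>v\<in>U (k + n). y v = x v)"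
        if "P (k + n) x \<and> (n = 0 \<longrightarrow> x = u0)" for x n
        using step[of "k + n" x] that by simp
    qed
    then obtain f where f: "\<And>n. P (k + n) (f n)" "f 0 = u0"
      and fSuc: "\<And>n v. v \<in> U (k + n) \<Longrightarrow> f (Suc n) v = f n v" by blast
    have stable: "f (n + i) v = f n v" if "v \<in> U (k + n)" for n i v
    proof (induction i)
      case (Suc i)
      have "v \<in> U (k + (n + i))" using that Umono[of "k + n" "k + (n + i)"] by auto
      then show ?case using Suc fSuc[of v "n + i"] by simp
    qed simp
    \<comment> \<open>The union of the coherent sequence: each vertex takes its value from its first stage.\<close>
    define w where "w v = f (LEAST n. v \<in> U (k + n)) v" for v
    have w: "w v = f n v" if "v \<in> U (k + n)" for n v
    proof -
      let ?l = "LEAST n. v \<in> U (k + n)"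
      have "v \<in> U (k + ?l)" using that by (rule LeastI)
      moreover have "?l \<le> n" using that by (rule Least_le)
      ultimately show ?thesis using stable[of v ?l "n - ?l"] by (simp add: w_def)
    qed
    have wF: "w \<in> F (k + n)" for n
    proof -
      obtain z where "z \<in> F (k + n)" "\<forall>v\<in>U (k + n). z v = f n v"
        using f(1)[of n] unfolding P_def by blast
      then show ?thesis using Fcong[of z "k + n" "k + n" w] w by simp
    qed
    have "infinitesimal_flex G p w"
      unfolding infinitesimal_flex_def
    proof (intro allI impI)
      fix a b assume e: "{a, b} \<in> edges G"
      then have "a \<in> verts G" "b \<in> verts G" using G by (auto simp: framework_def simple_graph_def)
      then obtain i j where "a \<in> U i" "b \<in> U j" using un by blast
      then have "a \<in> U (k + (i + j))" "b \<in> U (k + (i + j))"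
        using Umono[of i "k + (i + j)"] Umono[of j "k + (i + j)"] by auto
      then have "{a, b} \<in> edges (induced_subgraph G (U (k + (i + j))))"
        using e by (simp add: induced_subgraph_def)
      then show "(\<lambda>t. norm (p a + t *\<^sub>R w a - (p b + t *\<^sub>R w b)) - norm (p a - p b)) \<in> o[at 0](\<lambda>t. t)"
        using wF[of "i + j"] by (simp add: F_def infinitesimal_flex_def)
    qed
    moreover have "w v = u v" if "v \<in> U k" for v
      using w[of v 0] that f(2) u0(2) by simp
    ultimately show ?thesis by (auto simp: extends_to_flex_def induced_subgraph_def)
  qed
  then show ?thesis using M(1) by blast
qed

section \<open>Rigid frameworks and their towers\<close>

text \<open>Exhaust \<open>G\<close> by the subgraphs induced on finite sets of vertices, and thin this sequence out so that
  a flex that extends to the next stage extends to all of \<open>G\<close>. Rigidity of \<open>G\<close> makes such a flex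
  trivial.\<close>

lemma rigid_imp_relatively_rigid_tower:
  fixes p :: "'v \<Rightarrow> 'a::real_normed_vector"
  assumes B: "finite B" "span B = (UNIV :: 'a set)"
    and G: "countable_framework G p" and rigid: "infinitesimally_rigid G p"
  shows "\<exists>Gs ps. contains_tower G p Gs ps \<and> vertex_complete G Gs \<and> relatively_rigid_tower Gs ps"
proof -
  have fw: "framework G p" and count: "countable (verts G)" and inf: "infinite (verts G)"
    using G by (auto simp: countable_framework_def)
  define U where "U n = from_nat_into (verts G) ` {..<n}" for n
  have fin: "finite (U n)" for n by (simp add: U_def)
  have inc: "incseq U" unfolding incseq_def U_def by (auto intro!: image_mono)
  have "verts G = range (from_nat_into (verts G))"
    using count inf by (metis finite.emptyI range_from_nat_into)
  then have un: "verts G = (\<Union>n. U n)" unfolding U_def by blast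
  define H where "H n = induced_subgraph G (U n)" for n
  obtain M where M: "\<And>k. k < M k"
    "\<And>k u. extends_to_flex (H k) u (H (M k)) p \<Longrightarrow> extends_to_flex (H k) u G p"
    using finite_stage_extension_imp_extension[OF B fw fin inc un] unfolding H_def by metis
  define s where "s = rec_nat 0 (\<lambda>_. M)"
  have s: "s (Suc k) = M (s k)" for k by (simp add: s_def)
  have "strict_mono s" using s M(1) by (simp add: strict_mono_Suc_iff)
  have UG: "U n \<subseteq> verts G" for n using un by blast
  have HG: "subframework (H n) p G p" for n unfolding H_def by (rule subframework_induced[OF fw UG])
  have HH: "subframework (H m) p (H n) p" if "m \<le> n" for m n
    unfolding H_def by (rule subframework_induced_mono[OF fw incseqD[OF inc that] UG])
  have "finite_framework (H n) p" for n
    using HG[of n] fin[of n] by (simp add: finite_framework_def subframework_def H_def induced_subgraph_def)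
  then have "contains_tower G p (\<lambda>k. H (s k)) (\<lambda>_. p)"
    using HG HH M(1) s by (simp add: contains_tower_def tower_def less_imp_le)
  moreover have "vertex_complete G (\<lambda>k. H (s k))"
  proof -
    have "U n \<subseteq> U (s n)" for n
      using incseqD[OF inc strict_mono_imp_increasing[OF \<open>strict_mono s\<close>]] .
    then have "(\<Union>n. U n) = (\<Union>n. U (s n))" by blast
    then show ?thesis by (simp add: vertex_complete_def H_def induced_subgraph_def un)
  qed
  moreover have "relatively_rigid_tower (\<lambda>k. H (s k)) (\<lambda>_. p)"
    unfolding relatively_rigid_tower_def relatively_infinitesimally_rigid_def
  proof (intro allI conjI impI notI)
    fix k
    show "subframework (H (s k)) p (H (s (Suc k))) p" using HH M(1) s by (simp add: less_imp_le)
  next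
    fix k u
    assume u: "nontrivial_flex (H (s k)) p u" and "extends_to_flex (H (s k)) u (H (s (Suc k))) p"
    then have "extends_to_flex (H (s k)) u G p" using M(2) s by simp
    then obtain u' where u': "infinitesimal_flex G p u'" "\<forall>v\<in>verts (H (s k)). u' v = u v"
      by (auto simp: extends_to_flex_def)
    then have "trivial_flex G p u'" using rigid by (simp add: infinitesimally_rigid_def)
    then obtain \<gamma> where "infinitesimal_rigid_motion \<gamma>" "\<forall>v\<in>verts G. u' v = \<gamma> (p v)"
      by (auto simp: trivial_flex_def)
    moreover have "verts (H (s k)) \<subseteq> verts G"
      using UG by (simp add: H_def induced_subgraph_def)
    ultimately have "trivial_flex (H (s k)) p u"
      using u u'(2) unfolding trivial_flex_def nontrivial_flex_def by (metis subsetD)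
    then show False using u by (simp add: nontrivial_flex_def)
  qed
  ultimately show ?thesis by blast
qed

theorem theorem3p10:
  fixes G :: "'v graph" and p :: "'v \<Rightarrow> 'a::real_normed_vector"
  assumes "\<exists>B::'a set. finite B \<and> span B = UNIV"
    and "countable_framework G p"
  shows "(infinitesimally_rigid G p \<longleftrightarrow>
           (\<exists>Gs ps. contains_tower G p Gs ps \<and> vertex_complete G Gs \<and> flex_cancellation Gs ps))
       \<and> (infinitesimally_rigid G p \<longleftrightarrow>
           (\<exists>Gs ps. contains_tower G p Gs ps \<and> vertex_complete G Gs \<and> relatively_rigid_tower Gs ps))"
proof -
  obtain B :: "'a set" where B: "finite B" "span B = UNIV" using assms(1) by blast
  show ?thesis
    using flex_cancellation_imp_rigid[OF B, of G p]
      rigid_imp_relatively_rigid_tower[OF B assms(2)]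
      relatively_rigid_imp_flex_cancellation
    by blast
qed

end
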